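(* Let $n\ge4$. For integers $a,a'$ with $0\le a<a'\le\lfloor\frac{n-4}{2}\rfloor$, $$E_{\mathcal{E}}\big((T_{n,3}^{a,n-4-a})^c\big)<E_{\mathcal{E}}\big((T_{n,3}^{a',n-4-a'})^c\big).$$ That is, $E_{\mathcal{E}}\big((T_{n,3}^{0,n-4})^c\big)<E_{\mathcal{E}}\big((T_{n,3}^{1,n-5})^c\big)<\cdots<E_{\mathcal{E}}\big((T_{n,3}^{\lfloor\frac{n-4}{2}\rfloor,\lceil\frac{n-4}{2}\rceil})^c\big)$.
   Context: For a connected graph $G$, the eccentricity matrix $\mathcal{E}(G)$ is the matrix indexed by $V(G)$ whose $(u,v)$-entry is $d_G(u,v)$ if $d_G(u,v)=\min\{e_G(u),e_G(v)\}$ and $0$ otherwise, where $d_G$ is the graph distance and $e_G(u)=\max_v d_G(u,v)$. The $\mathcal{E}$-energy $E_{\mathcal{E}}(G)$ is the sum of the absolute values of the eigenvalues of $\mathcal{E}(G)$. $T^c$ is the complement of $T$. For $b\ge a\ge0$ with $a+b=n-4$, $T_{n,3}^{a,b}$ is the tree obtained from the path $v_0v_1v_2v_3$ by attaching $a$ pendant vertices to $v_1$ and $b$ pendant vertices to $v_2$. *)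

theory Defs
  imports
    "Graph_Theory.Graph_Theory"
    "Jordan_Normal_Form.Spectral_Radius"
begin

text \<open>
  A finite simple graph is a \<open>pair_graph\<close>: a digraph without loops and parallel arcs whose
  arc relation is symmetric, so that an edge \<open>{u, v}\<close> is the pair of arcs \<open>(u, v)\<close>, \<open>(v, u)\<close>.
\<close>

definition complement :: "'a pair_pre_digraph \<Rightarrow> 'a pair_pre_digraph" where
  "complement G =
     \<lparr> pverts = pverts G,
       parcs = {(u, v). u \<in> pverts G \<and> v \<in> pverts G \<and> u \<noteq> v \<and> (u, v) \<notin> parcs G} \<rparr>"

text \<open>
  With unit weights \<open>\<mu>\<close> is the least number of arcs of a walk. It is \<open>\<infinity>\<close> if there is no walk,
  so the following definitions are meaningful for connected graphs only.
\<close>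

definition gdist :: "'a pair_pre_digraph \<Rightarrow> 'a \<Rightarrow> 'a \<Rightarrow> real" where
  "gdist G u v = real_of_ereal (wf_digraph.\<mu> (with_proj G) (\<lambda>_. 1) u v)"

definition eccentricity :: "'a pair_pre_digraph \<Rightarrow> 'a \<Rightarrow> real" where
  "eccentricity G u = Max ((\<lambda>v. gdist G u v) ` pverts G)"

text \<open>Rows and columns follow the increasing enumeration of the vertices.\<close>

definition eccentricity_matrix :: "'a::linorder pair_pre_digraph \<Rightarrow> real mat" where
  "eccentricity_matrix G =
     (let vs = sorted_list_of_set (pverts G)
      in mat (length vs) (length vs) (\<lambda>(i, j).
           let u = vs ! i; v = vs ! j
           in if gdist G u v = min (eccentricity G u) (eccentricity G v)
              then gdist G u v else 0))"

text \<open>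
  Eigenvalues are counted with multiplicity. The eccentricity matrix of a connected graph is
  real symmetric, so its real eigenvalues are all its eigenvalues, and algebraic and geometric
  multiplicities agree.
\<close>

definition ecc_energy :: "'a::linorder pair_pre_digraph \<Rightarrow> real" where
  "ecc_energy G =
     (\<Sum>x \<in> spectrum (eccentricity_matrix G).
        real (Polynomial.order x (char_poly (eccentricity_matrix G))) * \<bar>x\<bar>)"

text \<open>
  The tree $T_{n,3}^{a,b}$ with \<open>n = a + b + 4\<close>: the path vertices \<open>v\<^sub>0, v\<^sub>1, v\<^sub>2, v\<^sub>3\<close>
  are \<open>0, 1, 2, 3\<close>, the pendant vertices at \<open>v\<^sub>1\<close> are \<open>4, \<dots>, a + 3\<close>, and those at
  \<open>v\<^sub>2\<close> are \<open>a + 4, \<dots>, a + b + 3\<close>.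
\<close>

definition tree_T3_edges :: "nat \<Rightarrow> nat \<Rightarrow> nat rel" where
  "tree_T3_edges a b =
     {(0, 1), (1, 2), (2, 3)} \<union> {1} \<times> {4..<4 + a} \<union> {2} \<times> {4 + a..<4 + a + b}"

definition tree_T3 :: "nat \<Rightarrow> nat \<Rightarrow> nat pair_pre_digraph" where
  "tree_T3 a b =
     \<lparr> pverts = {0..<a + b + 4}, parcs = tree_T3_edges a b \<union> (tree_T3_edges a b)\<inverse> \<rparr>"

lemma pair_graph_complement:
  assumes "pair_graph G"
  shows "pair_graph (complement G)"
proof -
  interpret pair_graph G by (rule assms)
  have s: "sym (parcs G)"
    using pair_sym_arcs by (simp add: symmetric_def)
  have "parcs (complement G) \<subseteq> pverts G \<times> pverts G"
    by (auto simp: complement_def)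
  then have "finite (parcs (complement G))"
    using pair_finite_verts finite_subset by blast
  moreover have "sym (parcs (complement G))"
    using s by (auto simp: complement_def sym_def)
  ultimately show ?thesis
    using pair_finite_verts
    by unfold_locales (auto simp: complement_def symmetric_def)
qed

lemma pair_graph_tree_T3: "pair_graph (tree_T3 a b)"
proof -
  have "sym (parcs (tree_T3 a b))"
    by (auto simp: tree_T3_def sym_def)
  moreover have "finite (parcs (tree_T3 a b))"
    by (simp add: tree_T3_def tree_T3_edges_def)
  ultimately show ?thesis
    by unfold_locales (auto simp: tree_T3_def tree_T3_edges_def symmetric_def)
qed

lemma connected_complement_tree_T3:
  "Digraph_Component.connected (with_proj (complement (tree_T3 a b)))"
proof -
  let ?C = "complement (tree_T3 a b)"
  interpret pair_graph ?C
    by (intro pair_graph_complement pair_graph_tree_T3)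
  have adj: "u \<rightarrow>\<^bsub>with_proj ?C\<^esub> v" if "(u, v) \<in> parcs ?C" for u v
    using that by simp
  have r0: "0 \<rightarrow>\<^sup>*\<^bsub>with_proj ?C\<^esub> v" if v: "v < a + b + 4" for v
  proof -
    have a03: "0 \<rightarrow>\<^sup>*\<^bsub>with_proj ?C\<^esub> 3"
      by (intro reachable_adjI adj) (simp add: complement_def tree_T3_def tree_T3_edges_def)
    have a02: "0 \<rightarrow>\<^sup>*\<^bsub>with_proj ?C\<^esub> 2"
      by (intro reachable_adjI adj) (simp add: complement_def tree_T3_def tree_T3_edges_def)
    have a31: "3 \<rightarrow>\<^sup>*\<^bsub>with_proj ?C\<^esub> 1"
      by (intro reachable_adjI adj) (simp add: complement_def tree_T3_def tree_T3_edges_def)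
    consider "v = 0" | "v = 1" | "v = 2" | "v \<ge> 3" by linarith
    then show ?thesis
    proof cases
      case 1
      have "0 \<in> pverts ?C" by (simp add: complement_def tree_T3_def)
      then show ?thesis using 1 by simp
    next
      case 2
      then show ?thesis using a03 a31 reachable_trans by blast
    next
      case 3
      then show ?thesis using a02 by simp
    next
      case 4
      then show ?thesis using v
        by (intro reachable_adjI adj) (simp add: complement_def tree_T3_def tree_T3_edges_def)
    qed
  qed
  have "u \<rightarrow>\<^sup>*\<^bsub>with_proj ?C\<^esub> v" if "u < a + b + 4" "v < a + b + 4" for u v
    using r0[OF that(1)] r0[OF that(2)] symmetric_reachable[OF pair_sym_arcs] reachable_trans
    by blast
  then have "strongly_connected (with_proj ?C)"
    unfolding strongly_connected_def by (auto simp: complement_def tree_T3_def)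
  moreover have "mk_symmetric (with_proj ?C) = ?C"
    by (rule pair_pre_digraph.equality)
      (auto simp: mk_symmetric_def complement_def tree_T3_def)
  ultimately show ?thesis
    by (simp add: connected_def)
qed

end

theory Submission
  imports Defs
begin

text \<open>
  In the complement of $T_{n,3}^{a,b}$ the vertices \<open>v\<^sub>1\<close> and \<open>v\<^sub>2\<close> have distance 3, a leaf and its
  neighbour in the tree have distance 2, and all other distances are at most 1. Hence the
  eccentricity matrix is the adjacency matrix of the tree in which \<open>v\<^sub>1v\<^sub>2\<close> has weight 3 and every
  other edge weight 2. Its entries depend only on the classes \<open>v\<^sub>1\<close>, \<open>v\<^sub>2\<close>, leaves at \<open>v\<^sub>1\<close>, leaves
  at \<open>v\<^sub>2\<close>, so it factors through a $4$-dimensional space, and exchanging the two factors gives the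
  characteristic polynomial $x^{n-4}(x^4 - (4p + 4q + 9)x^2 + 16pq)$ with $p = a + 1$,
  $q = b + 1$. Its nonzero roots are $\pm s, \pm t$ with
  $(s + t)^2 = 4p + 4q + 9 + 8\sqrt{pq}$. The energy is $2(s + t)$, and $p + q$ is fixed while $pq$
  grows with $a$.
\<close>

section \<open>Distances in the complement\<close>

text \<open>With unit weights a walk costs its length, so the infimum over walks that defines the
  distance is attained at any walk of least length.\<close>

lemma gdist_eqI:
  assumes "wf_digraph (with_proj G)"
    and "pre_digraph.awalk (with_proj G) u p v"
    and "\<And>q. pre_digraph.awalk (with_proj G) u q v \<Longrightarrow> length p \<le> length q"
  shows "gdist G u v = real (length p)"
proof -
  interpret wf_digraph "with_proj G" by (rule assms)
  have cost: "awalk_cost (\<lambda>_. 1) q = real (length q)" for q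
    by (induction q) auto
  have "\<mu> (\<lambda>_. 1) u v = ereal (real (length p))"
    unfolding \<mu>_def cost
    by (rule INF_eqI) (use assms in auto)
  then show ?thesis by (simp add: gdist_def)
qed

context pair_wf_digraph
begin

lemma gdist_self: "u \<in> pverts G \<Longrightarrow> gdist G u u = 0"
  using gdist_eqI[OF wf_digraph_axioms, of u "[]" u] by (simp add: awalk_Nil_iff)

lemma gdist_eq_1I:
  assumes "u \<noteq> v" "(u, v) \<in> parcs G"
  shows "gdist G u v = 1"
proof -
  have "1 \<le> length q" if "awalk u q v" for q
    using that assms by (cases q) (auto simp: awalk_Nil_iff)
  moreover have "awalk u [(u, v)] v"
    using assms by (auto simp: awalk_Cons_iff awalk_Nil_iff dest: in_arcsD2)
  ultimately show ?thesis
    using gdist_eqI[OF wf_digraph_axioms, of u "[(u, v)]" v] by simp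
qed

lemma gdist_eq_2I:
  assumes "u \<noteq> v" "(u, v) \<notin> parcs G" "(u, w) \<in> parcs G" "(w, v) \<in> parcs G"
  shows "gdist G u v = 2"
proof -
  have "2 \<le> length q" if q: "awalk u q v" for q
  proof (rule ccontr)
    assume "\<not> 2 \<le> length q"
    then have "length q = 0 \<or> length q = Suc 0" by linarith
    then show False
      using q assms(1,2) by (auto simp: length_Suc_conv awalk_Cons_iff awalk_Nil_iff)
  qed
  moreover have "awalk u [(u, w), (w, v)] v"
    using assms by (auto simp: awalk_Cons_iff awalk_Nil_iff dest: in_arcsD2)
  ultimately show ?thesis
    using gdist_eqI[OF wf_digraph_axioms, of u "[(u, w), (w, v)]" v]
    by (simp add: numeral_2_eq_2)
qed

lemma gdist_eq_3I:
  assumes "u \<noteq> v" "(u, v) \<notin> parcs G" "\<And>w. (u, w) \<in> parcs G \<Longrightarrow> (w, v) \<notin> parcs G"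
    and "(u, x) \<in> parcs G" "(x, y) \<in> parcs G" "(y, v) \<in> parcs G"
  shows "gdist G u v = 3"
proof -
  have "3 \<le> length q" if q: "awalk u q v" for q
  proof (rule ccontr)
    assume "\<not> 3 \<le> length q"
    then have "length q = 0 \<or> length q = Suc 0 \<or> length q = Suc (Suc 0)" by linarith
    then show False
      using q assms(1-3) by (auto simp: length_Suc_conv awalk_Cons_iff awalk_Nil_iff)
  qed
  moreover have "awalk u [(u, x), (x, y), (y, v)] v"
    using assms by (auto simp: awalk_Cons_iff awalk_Nil_iff dest: in_arcsD2)
  ultimately show ?thesis
    using gdist_eqI[OF wf_digraph_axioms, of u "[(u, x), (x, y), (y, v)]" v]
    by (simp add: numeral_3_eq_3)
qed

end

section \<open>Distances, eccentricities and matrix entries for the complemented tree\<close>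

lemma mem_parcs_tree_T3:
  "(u, v) \<in> parcs (tree_T3 a b) \<longleftrightarrow>
     (u, v) \<in> tree_T3_edges a b \<or> (v, u) \<in> tree_T3_edges a b"
  by (auto simp: tree_T3_def)

lemma mem_tree_T3_edges:
  "(u, v) \<in> tree_T3_edges a b \<longleftrightarrow>
     u = 0 \<and> v = 1 \<or> u = 1 \<and> v = 2 \<or> u = 2 \<and> v = 3 \<or>
     u = 1 \<and> 4 \<le> v \<and> v < 4 + a \<or> u = 2 \<and> 4 + a \<le> v \<and> v < 4 + a + b"
  by (auto simp: tree_T3_edges_def)

lemma mem_parcs_complement_tree_T3:
  "(u, v) \<in> parcs (complement (tree_T3 a b)) \<longleftrightarrow>
     u < a + b + 4 \<and> v < a + b + 4 \<and> u \<noteq> v \<and>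
     (u, v) \<notin> tree_T3_edges a b \<and> (v, u) \<notin> tree_T3_edges a b"
  by (auto simp: complement_def mem_parcs_tree_T3) (auto simp: tree_T3_def)

lemma pverts_complement_tree_T3: "pverts (complement (tree_T3 a b)) = {0..<a + b + 4}"
  by (simp add: complement_def tree_T3_def)

lemmas tree_T3_simps = mem_tree_T3_edges mem_parcs_complement_tree_T3

text \<open>In the complement, v3 is a common neighbour of v1 and its leaves, and v0 one of v2 and
  its leaves. Every remaining vertex is joined in the tree to v1 or v2, so v1 and v2 have no common
  neighbour in the complement.\<close>

lemma gdist_complement_tree_T3:
  assumes u: "u < a + b + 4" and v: "v < a + b + 4"
  shows "gdist (complement (tree_T3 a b)) u v =
    (if u = v then 0
     else if {u, v} = {1, 2} then 3
     else if (u, v) \<in> tree_T3_edges a b \<or> (v, u) \<in> tree_T3_edges a b then 2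
     else 1)"
proof -
  let ?C = "complement (tree_T3 a b)"
  interpret pair_graph ?C
    by (intro pair_graph_complement pair_graph_tree_T3)
  consider "u = v" | "u = 1" "v = 2" | "u = 2" "v = 1"
    | "u \<noteq> v" "(u, v) \<in> parcs ?C"
    | "u = 1" "v = 0 \<or> 4 \<le> v \<and> v < 4 + a" | "v = 1" "u = 0 \<or> 4 \<le> u \<and> u < 4 + a"
    | "u = 2" "v = 3 \<or> 4 + a \<le> v" | "v = 2" "u = 3 \<or> 4 + a \<le> u"
    using u v unfolding mem_parcs_complement_tree_T3 mem_tree_T3_edges by blast
  then show ?thesis
  proof cases
    case 1
    then show ?thesis using u gdist_self by (simp add: pverts_complement_tree_T3)
  next
    case 2
    \<comment> \<open>The walk v1, v3, v0, v2 uses only non-edges of the tree.\<close>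
    have "gdist ?C u v = 3"
      by (rule gdist_eq_3I[where x = 3 and y = 0]) (use 2 in \<open>auto simp: tree_T3_simps\<close>)
    then show ?thesis using 2 by simp
  next
    case 3
    have "gdist ?C u v = 3"
      by (rule gdist_eq_3I[where x = 0 and y = 3]) (use 3 in \<open>auto simp: tree_T3_simps\<close>)
    then show ?thesis using 3 by (simp add: insert_commute)
  next
    case 4
    have "gdist ?C u v = 1" using 4 by (rule gdist_eq_1I)
    moreover have "{u, v} \<noteq> {1, 2}"
      using 4 by (auto simp: tree_T3_simps doubleton_eq_iff)
    ultimately show ?thesis using 4 by (simp add: mem_parcs_complement_tree_T3)
  next
    case 5
    have "gdist ?C u v = 2"
      by (rule gdist_eq_2I[where w = 3]; insert 5 u v; elim disjE; simp add: tree_T3_simps)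
    then show ?thesis using 5 u v
      by (elim disjE; simp add: mem_tree_T3_edges doubleton_eq_iff)
  next
    case 6
    have "gdist ?C u v = 2"
      by (rule gdist_eq_2I[where w = 3]; insert 6 u v; elim disjE; simp add: tree_T3_simps)
    then show ?thesis using 6 u v
      by (elim disjE; simp add: mem_tree_T3_edges doubleton_eq_iff)
  next
    case 7
    have "gdist ?C u v = 2"
      by (rule gdist_eq_2I[where w = 0]; insert 7 u v; elim disjE; simp add: tree_T3_simps)
    then show ?thesis using 7 u v
      by (elim disjE; simp add: mem_tree_T3_edges doubleton_eq_iff)
  next
    case 8
    have "gdist ?C u v = 2"
      by (rule gdist_eq_2I[where w = 0]; insert 8 u v; elim disjE; simp add: tree_T3_simps)
    then show ?thesis using 8 u v
      by (elim disjE; simp add: mem_tree_T3_edges doubleton_eq_iff)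
  qed
qed

lemma eccentricity_complement_tree_T3:
  assumes u: "u < a + b + 4"
  shows "eccentricity (complement (tree_T3 a b)) u = (if u = 1 \<or> u = 2 then 3 else 2)"
proof -
  let ?C = "complement (tree_T3 a b)"
  \<comment> \<open>A vertex at greatest distance from \<open>u\<close>: v1 and v2 serve each other,
    and a leaf takes its neighbour in the tree.\<close>
  let ?w = "if u = 1 then 2 else if u = 2 then 1
            else if u = 0 \<or> 4 \<le> u \<and> u < 4 + a then 1 else 2"
  let ?r = "if u = 1 \<or> u = 2 then 3 else 2 :: real"
  have w: "?w \<in> pverts ?C"
    by (simp add: pverts_complement_tree_T3)
  have "gdist ?C u ?w = ?r"
    using u by (simp add: gdist_complement_tree_T3 mem_tree_T3_edges doubleton_eq_iff)
  then have "?r \<in> (\<lambda>v. gdist ?C u v) ` pverts ?C"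
    using imageI[OF w, of "gdist ?C u"] by (simp only:)
  then show ?thesis
    unfolding eccentricity_def
    using u by (intro Max_eqI)
      (auto simp: pverts_complement_tree_T3 gdist_complement_tree_T3 doubleton_eq_iff)
qed

text \<open>All eccentricities are at least 2, so the distances 0 and 1 never reach the minimum and
  turn into 0. For distinct vertices the minimum is 3 exactly for the pair v1, v2, and tree edges at
  a leaf keep their distance 2.\<close>

lemma eccentricity_matrix_complement_tree_T3:
  "eccentricity_matrix (complement (tree_T3 a b)) =
     mat (a + b + 4) (a + b + 4) (\<lambda>(u, v).
       if {u, v} = {1, 2} then 3
       else if (u, v) \<in> tree_T3_edges a b \<or> (v, u) \<in> tree_T3_edges a b then 2
       else 0)"
proof -
  let ?C = "complement (tree_T3 a b)"
  have irrefl: "(u, u) \<notin> tree_T3_edges a b" for u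
    by (auto simp: mem_tree_T3_edges)
  have entry: "(if gdist ?C u v = min (eccentricity ?C u) (eccentricity ?C v) then gdist ?C u v else 0) =
      (if {u, v} = {1, 2} then 3
       else if (u, v) \<in> tree_T3_edges a b \<or> (v, u) \<in> tree_T3_edges a b then 2
       else 0)" if uv: "u < a + b + 4" "v < a + b + 4" for u v
  proof -
    note ge = gdist_complement_tree_T3 eccentricity_complement_tree_T3
    consider "u = v" | "u = 1" "v = 2" | "u = 2" "v = 1" | "u \<noteq> v" "{u, v} \<noteq> {1, 2}"
      by (auto simp: doubleton_eq_iff)
    then show ?thesis
    proof cases
      case 4
      then have "min (eccentricity ?C u) (eccentricity ?C v) = 2"
        using uv by (auto simp: ge doubleton_eq_iff)
      then show ?thesis using 4 uv by (simp add: ge)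
    qed (use uv in \<open>simp_all add: ge irrefl doubleton_eq_iff\<close>)
  qed
  show ?thesis
  proof (rule eq_matI, goal_cases)
    case (1 i j)
    then have ij: "i < a + b + 4" "j < a + b + 4" by simp_all
    then show ?case
      using entry[OF ij]
      by (simp add: eccentricity_matrix_def pverts_complement_tree_T3 Let_def split del: if_split
          cong: if_cong)
  qed (simp_all add: eccentricity_matrix_def pverts_complement_tree_T3 Let_def)
qed

section \<open>Characteristic polynomials and spectra\<close>

text \<open>A form of Sylvester's determinant identity. The block matrix \<open>?L\<close> becomes
  block triangular both when multiplied by \<open>?R\<close> on the right and when multiplied by
  \<open>?S\<close> on the left; comparing determinants gives the two sides. The powers of
  \<open>x\<close> avoid any division.\<close>

lemma det_scalar_minus_mult_comm:
  fixes x :: "'a::idom"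
  assumes U: "U \<in> carrier_mat n k" and V: "V \<in> carrier_mat k n"
  shows "x ^ k * det (x \<cdot>\<^sub>m 1\<^sub>m n - U * V) = x ^ n * det (x \<cdot>\<^sub>m 1\<^sub>m k - V * U)"
proof -
  let ?L = "four_block_mat (x \<cdot>\<^sub>m 1\<^sub>m n) U V (1\<^sub>m k)"
  let ?R = "four_block_mat (1\<^sub>m n) (0\<^sub>m n k) (- V) (1\<^sub>m k)"
  let ?S = "four_block_mat (1\<^sub>m n) (0\<^sub>m n k) (- V) (x \<cdot>\<^sub>m 1\<^sub>m k)"
  have L: "?L \<in> carrier_mat (n + k) (n + k)" "?R \<in> carrier_mat (n + k) (n + k)"
      "?S \<in> carrier_mat (n + k) (n + k)"
    using U V by auto
  have "?L * ?R = four_block_mat (x \<cdot>\<^sub>m 1\<^sub>m n - U * V) U (0\<^sub>m k n) (1\<^sub>m k)"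
    using U V by (subst mult_four_block_mat[of _ n n _ k _ k])
      (auto intro!: arg_cong2[where f = "\<lambda>X Y. four_block_mat X U Y (1\<^sub>m k)"])
  moreover have "det ?R = 1"
    using V by (subst det_four_block_mat_upper_right_zero[of _ n _ k]) auto
  moreover have "det (four_block_mat (x \<cdot>\<^sub>m 1\<^sub>m n - U * V) U (0\<^sub>m k n) (1\<^sub>m k)) =
      det (x \<cdot>\<^sub>m 1\<^sub>m n - U * V)"
    using U V by (subst det_four_block_mat_lower_left_zero[of _ n _ k]) auto
  ultimately have 1: "det ?L = det (x \<cdot>\<^sub>m 1\<^sub>m n - U * V)"
    using det_mult[OF L(1,2)] by simp
  have "?S * ?L = four_block_mat (x \<cdot>\<^sub>m 1\<^sub>m n) U (0\<^sub>m k n) (x \<cdot>\<^sub>m 1\<^sub>m k - V * U)"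
    using U V by (subst mult_four_block_mat[of _ n n _ k _ k])
      (auto intro!: arg_cong2[where f = "\<lambda>X Y. four_block_mat (x \<cdot>\<^sub>m 1\<^sub>m n) U X Y"])
  moreover have "det ?S = x ^ k"
    using V by (subst det_four_block_mat_upper_right_zero[of _ n _ k]) auto
  moreover have "det (four_block_mat (x \<cdot>\<^sub>m 1\<^sub>m n) U (0\<^sub>m k n) (x \<cdot>\<^sub>m 1\<^sub>m k - V * U)) =
      x ^ n * det (x \<cdot>\<^sub>m 1\<^sub>m k - V * U)"
    using U V by (subst det_four_block_mat_lower_left_zero[of _ n _ k]) auto
  ultimately have "x ^ k * det ?L = x ^ n * det (x \<cdot>\<^sub>m 1\<^sub>m k - V * U)"
    using det_mult[OF L(3,1)] by simp
  with 1 show ?thesis by simp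
qed

text \<open>The determinant identity is applied over the polynomial ring, with the indeterminate as
  \<open>x\<close> and the entries embedded as constants.\<close>

lemma char_poly_mult_comm:
  fixes U :: "'a::idom mat"
  assumes U: "U \<in> carrier_mat n k" and V: "V \<in> carrier_mat k n"
  shows "monom 1 k * char_poly (U * V) = monom 1 n * char_poly (V * U)"
proof -
  have cp: "char_poly (A * B) =
      det (monom 1 1 \<cdot>\<^sub>m 1\<^sub>m i - map_mat (\<lambda>c. [:c:]) A * map_mat (\<lambda>c. [:c:]) B)"
    if A: "A \<in> carrier_mat i j" and B: "B \<in> carrier_mat j i" for A B :: "'a mat" and i j
  proof -
    interpret h: comm_ring_hom "\<lambda>c::'a. [:c:]"
      by unfold_locales auto
    show ?thesis
      unfolding char_poly_defs h.mat_hom_mult[OF A B, symmetric]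
      using A B by (intro arg_cong[of _ _ det] eq_matI) (auto simp: monom_Suc)
  qed
  show ?thesis
    unfolding cp[OF U V] cp[OF V U]
    using det_scalar_minus_mult_comm
        [of "map_mat (\<lambda>c. [:c:]) U" n k "map_mat (\<lambda>c. [:c:]) V" "monom 1 1"] U V
    by (simp add: monom_power)
qed

text \<open>The large matrix is \<open>?U * ?V\<close>, where \<open>?U\<close> is the 0-1 incidence
  matrix of indices and classes. In \<open>?V * ?U\<close> equal columns of \<open>?V\<close> are
  added up, which produces the class sizes.\<close>

lemma char_poly_mat_of_classes:
  fixes w :: "nat \<Rightarrow> nat \<Rightarrow> 'a::idom"
  assumes c: "\<And>i. i < n \<Longrightarrow> c i < k"
  shows "monom 1 k * char_poly (mat n n (\<lambda>(i, j). w (c i) (c j))) =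
    monom 1 n * char_poly (mat k k (\<lambda>(i, j). w i j * of_nat (card {l. l < n \<and> c l = j})))"
proof -
  let ?U = "mat n k (\<lambda>(i, j). of_bool (c i = j)) :: 'a mat"
  let ?V = "mat k n (\<lambda>(i, j). w i (c j)) :: 'a mat"
  have "?U * ?V = mat n n (\<lambda>(i, j). w (c i) (c j))"
    using c by (intro eq_matI)
      (simp_all add: scalar_prod_def of_bool_def if_distrib if_distribR cong: if_cong)
  moreover have "?V * ?U = mat k k (\<lambda>(i, j). w i j * of_nat (card {l. l < n \<and> c l = j}))"
  proof -
    have "(\<Sum>l\<in>{0..<n} \<inter> {l. c l = j}. w i (c l)) =
        w i j * of_nat (card {l. l < n \<and> c l = j})" for i j
    proof -
      have "{0..<n} \<inter> {l. c l = j} = {l. l < n \<and> c l = j}" by auto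
      then show ?thesis by (simp add: mult.commute)
    qed
    then show ?thesis
      by (intro eq_matI) (simp_all add: scalar_prod_def)
  qed
  ultimately show ?thesis
    using char_poly_mult_comm[of ?U n k ?V] by simp
qed

lemma det_2x2:
  fixes A :: "'a::comm_ring_1 mat"
  assumes "A \<in> carrier_mat 2 2"
  shows "det A = A $$ (0, 0) * A $$ (1, 1) - A $$ (0, 1) * A $$ (1, 0)"
proof -
  have "det (mat_delete A 0 j) = mat_delete A 0 j $$ (0, 0)" if "j < 2" for j
    using assms that mat_delete_carrier[of A 1 1 0 j] by (intro det_single) auto
  then show ?thesis
    using assms by (simp add: laplace_expansion_row[OF assms, of 0] cofactor_def numeral_2_eq_2
        mat_delete_def)
qed

text \<open>
  The classes are \<open>v\<^sub>1\<close>, \<open>v\<^sub>2\<close>, the leaves at \<open>v\<^sub>1\<close> and the leaves at \<open>v\<^sub>2\<close>; the path ends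
  \<open>v\<^sub>0\<close> and \<open>v\<^sub>3\<close> count as leaves.
\<close>

definition T3_class :: "nat \<Rightarrow> nat \<Rightarrow> nat" where
  "T3_class a v = (if v = 1 then 0 else if v = 2 then 1
     else if v = 0 \<or> 4 \<le> v \<and> v < 4 + a then 2 else 3)"

text \<open>The class graph is a path with edge weights 2, 3, 2: leaves at v1, v1, v2, leaves at
  v2.\<close>

definition T3_weight :: "nat \<Rightarrow> nat \<Rightarrow> real" where
  "T3_weight i j = [[0, 3, 2, 0], [3, 0, 0, 2], [2, 0, 0, 0], [0, 2, 0, 0]] ! i ! j"

lemma card_T3_class:
  "card {v. v < a + b + 4 \<and> T3_class a v = 0} = 1"
  "card {v. v < a + b + 4 \<and> T3_class a v = 1} = 1"
  "card {v. v < a + b + 4 \<and> T3_class a v = 2} = a + 1"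
  "card {v. v < a + b + 4 \<and> T3_class a v = 3} = b + 1"
proof -
  have "{v. v < a + b + 4 \<and> T3_class a v = 0} = {1}"
    "{v. v < a + b + 4 \<and> T3_class a v = 1} = {2}"
    "{v. v < a + b + 4 \<and> T3_class a v = 2} = insert 0 {4..<4 + a}"
    "{v. v < a + b + 4 \<and> T3_class a v = 3} = insert 3 {4 + a..<4 + a + b}"
    by (auto simp: T3_class_def split: if_splits)
  then show "card {v. v < a + b + 4 \<and> T3_class a v = 0} = 1"
    "card {v. v < a + b + 4 \<and> T3_class a v = 1} = 1"
    "card {v. v < a + b + 4 \<and> T3_class a v = 2} = a + 1"
    "card {v. v < a + b + 4 \<and> T3_class a v = 3} = b + 1"
    by simp_all
qed

text \<open>The lower blocks \<open>?C\<close> and \<open>?D\<close> are scalar and hence commute,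
  so the determinant reduces to the 2 by 2 one of \<open>?A * ?D - ?B * ?C\<close>, which is
  \<open>(x^2 - 4p)(x^2 - 4q) - 9x^2\<close>.\<close>

lemma char_poly_T3_quotient:
  fixes p q :: real
  shows "char_poly (mat 4 4 (\<lambda>(i, j). T3_weight i j * [1, 1, p, q] ! j)) =
    [:16 * p * q, 0, - (4 * p + 4 * q + 9), 0, 1:]"
proof -
  let ?A = "mat 2 2 (\<lambda>(i, j). if i = j then [:0, 1:] else [:-3:]) :: real poly mat"
  let ?B = "mat 2 2 (\<lambda>(i, j). if i = j then [:- 2 * (if i = 0 then p else q):] else 0)"
  let ?C = "[:-2:] \<cdot>\<^sub>m 1\<^sub>m 2 :: real poly mat"
  let ?D = "[:0, 1:] \<cdot>\<^sub>m 1\<^sub>m 2 :: real poly mat"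
  have less4: "i < 4 \<longleftrightarrow> i \<in> {0, 1, 2, 3}" for i :: nat by auto
  have "char_poly_matrix (mat 4 4 (\<lambda>(i, j). T3_weight i j * [1, 1, p, q] ! j)) =
      four_block_mat ?A ?B ?C ?D"
    by (rule eq_matI) (auto simp: char_poly_matrix_def T3_weight_def less4)
  then have "char_poly (mat 4 4 (\<lambda>(i, j). T3_weight i j * [1, 1, p, q] ! j)) =
      det (?A * ?D - ?B * ?C)"
    unfolding char_poly_def by (simp, intro det_four_block_mat[of _ 2]) (auto simp: scalar_prod_def)
  also have "\<dots> = [:16 * p * q, 0, - (4 * p + 4 * q + 9), 0, 1:]"
    by (subst det_2x2) (auto simp: scalar_prod_def numeral_2_eq_2)
  finally show ?thesis .
qed

section \<open>From the roots of the characteristic polynomial to the energy\<close>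

lemma order_prod_linear:
  fixes S :: "'a::idom set"
  assumes "finite S"
  shows "order x (\<Prod>r\<in>S. [:- r, 1:]) = of_bool (x \<in> S)"
  using assms
proof (induction S)
  case (insert r S)
  have "(\<Prod>r\<in>insert r S. [:- r, 1:]) \<noteq> 0"
    using insert.hyps by (subst prod_zero_iff) auto
  then show ?case
    using insert by (auto simp: order_mult order_linear' simp del: mult_pCons_left)
qed simp

text \<open>The nonzero eigenvalues are exactly the elements of \<open>S\<close>, each a simple
  root; the eigenvalue 0 contributes nothing, whatever its multiplicity.\<close>

lemma sum_order_abs_spectrum:
  fixes A :: "real mat"
  assumes A: "A \<in> carrier_mat n n" and S: "finite S" "0 \<notin> S"
    and cp: "char_poly A = monom 1 m * (\<Prod>r\<in>S. [:- r, 1:])"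
  shows "(\<Sum>x\<in>spectrum A. real (order x (char_poly A)) * \<bar>x\<bar>) = (\<Sum>r\<in>S. \<bar>r\<bar>)"
proof -
  have ne: "monom 1 m * (\<Prod>r\<in>S. [:- r, 1:]) \<noteq> (0 :: real poly)"
    using S by simp
  have ord: "order x (char_poly A) = of_bool (x \<in> S)" if "x \<noteq> 0" for x
    using that S unfolding cp order_mult[OF ne]
    by (simp add: order_prod_linear order_0I poly_monom)
  have sub: "S \<subseteq> spectrum A"
    using S unfolding spectrum_root_char_poly[OF A] cp
    by (auto simp: poly_prod)
  have "(\<Sum>x\<in>spectrum A. real (order x (char_poly A)) * \<bar>x\<bar>) =
      (\<Sum>x\<in>S. real (order x (char_poly A)) * \<bar>x\<bar>)"
    using sub card_finite_spectrum(1)[OF A] ord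
    by (intro sum.mono_neutral_right) auto
  also have "\<dots> = (\<Sum>r\<in>S. \<bar>r\<bar>)"
  proof (rule sum.cong)
    fix x assume "x \<in> S"
    then have "order x (char_poly A) = 1"
      using S(2) ord[of x] by (cases "x = 0") auto
    then show "real (order x (char_poly A)) * \<bar>x\<bar> = \<bar>x\<bar>" by simp
  qed simp
  finally show ?thesis .
qed

text \<open>Solving \<open>s * t = P\<close> and \<open>s^2 + t^2 = R\<close> means that the squares
  of \<open>s + t\<close> and \<open>s - t\<close> are \<open>R + 2 * P\<close> and
  \<open>R - 2 * P\<close>. The strict hypotheses make the four roots distinct, so the product over
  a set really has four factors.\<close>

lemma biquadratic_factorization:
  fixes P R :: real
  assumes "0 < P" "2 * P < R"
  obtains s t where "0 < t" "t < s" "s + t = sqrt (R + 2 * P)"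
    "[:P\<^sup>2, 0, - R, 0, 1:] = (\<Prod>r\<in>{s, - s, t, - t}. [:- r, 1:])"
proof -
  define u where "u = sqrt (R + 2 * P)"
  define v where "v = sqrt (R - 2 * P)"
  have uv: "0 < v" "v < u" "u\<^sup>2 = R + 2 * P" "v\<^sup>2 = R - 2 * P"
    using assms by (auto simp: u_def v_def)
  define s where "s = (u + v) / 2"
  define t where "t = (u - v) / 2"
  have st: "0 < t" "t < s" "s + t = u"
    using uv by (auto simp: s_def t_def field_simps)
  have "R = s\<^sup>2 + t\<^sup>2" "P = s * t"
    using uv(3,4) by (auto simp: s_def t_def power2_eq_square field_simps)
  moreover have "(\<Prod>r\<in>{s, - s, t, - t}. [:- r, 1:]) =
      [:(s * t)\<^sup>2, 0, - (s\<^sup>2 + t\<^sup>2), 0, 1:]"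
    using st by (simp add: power2_eq_square algebra_simps)
  ultimately show ?thesis
    using that st by (simp add: u_def)
qed

section \<open>Characteristic polynomial and energy of the complemented tree\<close>

lemma eccentricity_matrix_complement_tree_T3_classes:
  "eccentricity_matrix (complement (tree_T3 a b)) =
     mat (a + b + 4) (a + b + 4) (\<lambda>(u, v). T3_weight (T3_class a u) (T3_class a v))"
  unfolding eccentricity_matrix_complement_tree_T3
proof (rule eq_matI)
  fix u v
  assume "u < dim_row (mat (a + b + 4) (a + b + 4)
      (\<lambda>(u, v). T3_weight (T3_class a u) (T3_class a v)))"
    "v < dim_col (mat (a + b + 4) (a + b + 4)
      (\<lambda>(u, v). T3_weight (T3_class a u) (T3_class a v)))"
  moreover have "u = 1 \<or> u = 2 \<or> u = 0 \<or> u = 3 \<or> 4 \<le> u \<and> u < 4 + a \<or> 4 + a \<le> u"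
    "v = 1 \<or> v = 2 \<or> v = 0 \<or> v = 3 \<or> 4 \<le> v \<and> v < 4 + a \<or> 4 + a \<le> v"
    by linarith+
  ultimately show "mat (a + b + 4) (a + b + 4) (\<lambda>(u, v).
       if {u, v} = {1, 2} then 3
       else if (u, v) \<in> tree_T3_edges a b \<or> (v, u) \<in> tree_T3_edges a b then 2
       else 0) $$ (u, v) =
     mat (a + b + 4) (a + b + 4) (\<lambda>(u, v). T3_weight (T3_class a u) (T3_class a v)) $$ (u, v)"
    by (elim disjE) (simp_all add: T3_weight_def T3_class_def mem_tree_T3_edges doubleton_eq_iff)
qed simp_all

lemma char_poly_eccentricity_matrix_complement_tree_T3:
  "char_poly (eccentricity_matrix (complement (tree_T3 a b))) =
    monom 1 (a + b) *
    [:16 * real (a + 1) * real (b + 1), 0, - (4 * real (a + 1) + 4 * real (b + 1) + 9), 0, 1:]"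
proof -
  let ?n = "a + b + 4"
  have "real (card {l. l < ?n \<and> T3_class a l = j}) = [1, 1, real (a + 1), real (b + 1)] ! j"
    if "j < 4" for j
  proof -
    have "j = 0 \<or> j = 1 \<or> j = 2 \<or> j = 3" using that by auto
    then show ?thesis
      by (elim disjE) (simp_all only: card_T3_class, simp_all)
  qed
  then have "mat 4 4 (\<lambda>(i, j). T3_weight i j * real (card {l. l < ?n \<and> T3_class a l = j})) =
      mat 4 4 (\<lambda>(i, j). T3_weight i j * [1, 1, real (a + 1), real (b + 1)] ! j)"
    by (intro cong_mat) (simp_all only: prod.case)
  moreover have "T3_class a i < 4" for i
    by (simp add: T3_class_def)
  \<comment> \<open>Here \<open>x^(a + b + 4)\<close> on the quotient side is split as
    \<open>x^4 * x^(a + b)\<close>, so that the factor \<open>x^4\<close> can be cancelled.\<close>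
  ultimately have "monom 1 4 * char_poly (eccentricity_matrix (complement (tree_T3 a b))) =
      monom 1 4 * (monom 1 (a + b) *
      [:16 * real (a + 1) * real (b + 1), 0, - (4 * real (a + 1) + 4 * real (b + 1) + 9), 0, 1:])"
    using char_poly_mat_of_classes[of ?n "T3_class a" 4 T3_weight]
    unfolding eccentricity_matrix_complement_tree_T3_classes
    by (simp only: char_poly_T3_quotient mult.assoc[symmetric] mult_monom) (simp add: add.commute)
  then show ?thesis
    by (subst (asm) mult_cancel_left) simp
qed

lemma ecc_energy_complement_tree_T3:
  "ecc_energy (complement (tree_T3 a b)) =
    2 * sqrt (4 * real (a + b) + 17 + 8 * sqrt (real ((a + 1) * (b + 1))))"
proof -
  define p where "p = real (a + 1)"
  define q where "q = real (b + 1)"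
  define P where "P = 4 * sqrt (p * q)"
  define R where "R = 4 * p + 4 * q + 9"
  have pq: "p > 0" "q > 0"
    by (simp_all add: p_def q_def)
  \<comment> \<open>The inequality of means gives \<open>2 * P\<close> at most
    \<open>4 * p + 4 * q\<close>; the summand 9 in \<open>R\<close> makes the bound strict.\<close>
  have "sqrt (p * q) \<le> (p + q) / 2"
    using pq by (intro arith_geo_mean_sqrt) auto
  with pq have P: "0 < P" "2 * P < R" "P\<^sup>2 = 16 * p * q"
    by (auto simp: P_def R_def power2_eq_square)
  obtain s t where st: "0 < t" "t < s" "s + t = sqrt (R + 2 * P)"
    "[:P\<^sup>2, 0, - R, 0, 1:] = (\<Prod>r\<in>{s, - s, t, - t}. [:- r, 1:])"
    using biquadratic_factorization P(1,2) by metis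
  let ?M = "eccentricity_matrix (complement (tree_T3 a b))"
  have "?M \<in> carrier_mat (a + b + 4) (a + b + 4)"
    by (simp add: eccentricity_matrix_complement_tree_T3)
  moreover have "char_poly ?M = monom 1 (a + b) * (\<Prod>r\<in>{s, - s, t, - t}. [:- r, 1:])"
    unfolding char_poly_eccentricity_matrix_complement_tree_T3 st(4)[symmetric] P(3) R_def p_def q_def ..
  ultimately have "ecc_energy (complement (tree_T3 a b)) = (\<Sum>r\<in>{s, - s, t, - t}. \<bar>r\<bar>)"
    unfolding ecc_energy_def using st(1,2) by (intro sum_order_abs_spectrum) auto
  also have "\<dots> = 2 * (s + t)"
    using st by simp
  also have "\<dots> = 2 * sqrt (4 * real (a + b) + 17 + 8 * sqrt (real ((a + 1) * (b + 1))))"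
    unfolding st(3) by (simp add: P_def R_def p_def q_def algebra_simps)
  finally show ?thesis .
qed

theorem theorem5p1:
  fixes n a a' :: nat
  assumes "n \<ge> 4"
    and "a < a'"
    and "a' \<le> (n - 4) div 2"
  shows "ecc_energy (complement (tree_T3 a (n - 4 - a)))
       < ecc_energy (complement (tree_T3 a' (n - 4 - a')))"
proof -
  obtain b' where b': "n - 4 = a' + b'" "a' \<le> b'"
    using assms(3) by (intro that[of "n - 4 - a'"]) auto
  obtain k where k: "a' = a + k" "0 < k"
    using assms(2) less_imp_add_positive by blast
  have eq: "n - 4 - a = b' + k" "n - 4 - a' = b'"
    using b' k by auto
  \<comment> \<open>Moving \<open>k\<close> leaves from v2 to v1 raises the product of the class
    sizes by \<open>k * (b' - a)\<close>. The subtraction is exact because \<open>a < a'\<close> and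
    \<open>a'\<close> is at most \<open>b'\<close>.\<close>
  have "(a + 1) * (b' + k + 1) + k * (b' - a) = (a + k + 1) * (b' + 1)"
    using b'(2) k(1) by (auto simp: algebra_simps le_iff_add)
  moreover have "0 < k * (b' - a)"
    using b'(2) k by simp
  ultimately have less: "(a + 1) * (b' + k + 1) < (a + k + 1) * (b' + 1)"
    by linarith
  \<comment> \<open>The number of added leaves is the same in both trees, so the energies differ
    only in the product under the inner root.\<close>
  have sum: "a + (b' + k) = a + k + b'"
    by simp
  show ?thesis
    unfolding eq unfolding ecc_energy_complement_tree_T3 k(1) sum
    using less by (simp only: real_sqrt_less_iff add_less_cancel_left mult_less_cancel_left_pos
        zero_less_numeral of_nat_less_iff)
qed

end
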